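(* If $X$ is an almost isometric ideal in a Banach space $Y$ and $Y$ has the Daugavet property, then $X$ has the Daugavet property.
   Context: All Banach spaces are real. A Banach space $Z$ has the Daugavet property if $\|I+T\|=1+\|T\|$ for every bounded linear rank 1 operator $T:Z\to Z$, where $I$ is the identity operator on $Z$. (In the claim $X$ is itself regarded as a Banach space.) A subspace $X$ of a Banach space $Y$ is an almost isometric ideal (ai-ideal) in $Y$ if for every $\varepsilon>0$ and every finite-dimensional subspace $E\subset Y$ there exists a linear operator $T:E\to X$ such that $Te=e$ for all $e\in X\cap E$ and $(1+\varepsilon)^{-1}\|e\|\le\|Te\|\le(1+\varepsilon)\|e\|$ for all $e\in E$. *)

theory Defs
  imports "HOL-Analysis.Analysis"
begin

text \<open>
  A Banach space \<open>Y\<close> is a type of class \<open>banach\<close>, and a Banach space \<open>X\<close> sitting inside it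
  is a closed subspace, i.e. a set. Operators between subspaces are total functions of which
  only the values on the domain matter. The whole space is \<open>UNIV\<close>.
\<close>

definition linear_map_on ::
    "'a::real_vector set \<Rightarrow> 'b::real_vector set \<Rightarrow> ('a \<Rightarrow> 'b) \<Rightarrow> bool" where
  "linear_map_on E F T \<longleftrightarrow>
     (\<forall>x\<in>E. T x \<in> F) \<and>
     (\<forall>x\<in>E. \<forall>y\<in>E. T (x + y) = T x + T y) \<and>
     (\<forall>c. \<forall>x\<in>E. T (c *\<^sub>R x) = c *\<^sub>R T x)"

definition bounded_linear_map_on ::
    "'a::real_normed_vector set \<Rightarrow> 'b::real_normed_vector set \<Rightarrow> ('a \<Rightarrow> 'b) \<Rightarrow> bool" where
  "bounded_linear_map_on E F T \<longleftrightarrow>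
     linear_map_on E F T \<and> (\<exists>K. \<forall>x\<in>E. norm (T x) \<le> norm x * K)"

text \<open>The relativisation of \<^const>\<open>onorm\<close>; the term for \<open>x = 0\<close> is \<open>0\<close>.\<close>

definition onorm_on ::
    "'a::real_normed_vector set \<Rightarrow> ('a \<Rightarrow> 'b::real_normed_vector) \<Rightarrow> real" where
  "onorm_on E T = (SUP x\<in>E. norm (T x) / norm x)"

text \<open>
  The library's \<^const>\<open>dim\<close> is \<open>0\<close> on infinite-dimensional spaces, so \<open>dim (T ` Z) = 1\<close> does
  say that \<open>T\<close> has rank exactly 1.
\<close>

definition daugavet_property :: "'a::real_normed_vector set \<Rightarrow> bool" where
  "daugavet_property Z \<longleftrightarrow>
     (\<forall>T. bounded_linear_map_on Z Z T \<and> dim (T ` Z) = 1 \<longrightarrow>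
          onorm_on Z (\<lambda>x. x + T x) = 1 + onorm_on Z T)"

definition finite_dim_subspace :: "'a::real_vector set \<Rightarrow> bool" where
  "finite_dim_subspace E \<longleftrightarrow> (\<exists>B. finite B \<and> E = span B)"

definition ai_ideal :: "'a::real_normed_vector set \<Rightarrow> bool" where
  "ai_ideal X \<longleftrightarrow>
     subspace X \<and>
     (\<forall>\<epsilon>>0. \<forall>E. finite_dim_subspace E \<longrightarrow>
        (\<exists>T. linear_map_on E X T \<and>
             (\<forall>e\<in>X \<inter> E. T e = e) \<and>
             (\<forall>e\<in>E. inverse (1 + \<epsilon>) * norm e \<le> norm (T e) \<and>
                      norm (T e) \<le> (1 + \<epsilon>) * norm e)))"

text \<open>On the whole space, the relative notions are the library's.\<close>

lemma bounded_linear_map_on_UNIV: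
  "bounded_linear_map_on UNIV UNIV T \<longleftrightarrow> bounded_linear T"
  by (auto simp: bounded_linear_map_on_def linear_map_on_def bounded_linear_def
      bounded_linear_axioms_def linear_iff)

lemma daugavet_property_UNIV:
  "daugavet_property (UNIV :: 'a::real_normed_vector set) \<longleftrightarrow>
     (\<forall>T :: 'a \<Rightarrow> 'a. bounded_linear T \<and> dim (range T) = 1 \<longrightarrow>
        onorm (\<lambda>x. x + T x) = 1 + onorm T)"
  by (simp add: daugavet_property_def bounded_linear_map_on_UNIV onorm_on_def onorm_def)

end

theory Submission
  imports Defs
begin

text \<open>
  A rank one operator on \<open>X\<close> is \<open>x \<mapsto> f x *\<^sub>R x\<^sub>0\<close> for a bounded functional \<open>f\<close> on \<open>X\<close> and some
  \<open>x\<^sub>0 \<in> X\<close>. An arbitrary Hahn--Banach extension of \<open>f\<close> to the whole space would not do: the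
  Daugavet property of the whole space yields a vector \<open>y\<close>, possibly outside \<open>X\<close>, at which
  \<open>y + F y *\<^sub>R x\<^sub>0\<close> is long, and moving \<open>y\<close> into \<open>X\<close> by an almost isometry \<open>T\<close> helps only if
  \<open>f (T y)\<close> is close to \<open>F y\<close>.

  The almost isometries themselves provide the right extension. The functions \<open>f \<circ> T\<close>, where
  \<open>T\<close> runs through the almost isometries on larger and larger finite-dimensional subspaces, lie
  in a product of compact intervals, so by Tychonoff they have a pointwise cluster point \<open>F\<close>.
  Linearity, agreement with \<open>f\<close> on \<open>X\<close> and the norm bound pass to the limit, and being a
  cluster point supplies \<open>f (T y) \<approx> F y\<close> (lemma \<open>ai_ideal_extension\<close>). Since \<open>T\<close> fixes \<open>x\<^sub>0\<close>,
  it maps \<open>y + F y *\<^sub>R x\<^sub>0\<close> to \<open>T y + F y *\<^sub>R x\<^sub>0 \<approx> T y + f (T y) *\<^sub>R x\<^sub>0\<close>. Hence every bound for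
  \<open>I + f \<otimes> x\<^sub>0\<close> on \<open>X\<close> is one for \<open>I + F \<otimes> x\<^sub>0\<close> on the whole space, where the Daugavet
  property says that the norm is \<open>1 + \<parallel>F \<otimes> x\<^sub>0\<parallel>\<close>, and \<open>\<parallel>F \<otimes> x\<^sub>0\<parallel> \<ge> \<parallel>f \<otimes> x\<^sub>0\<parallel>\<close>.
\<close>

section \<open>Almost isometries into an ideal\<close>

definition ai_operator ::
    "'a::real_normed_vector set \<Rightarrow> real \<Rightarrow> 'a set \<Rightarrow> ('a \<Rightarrow> 'a) \<Rightarrow> bool" where
  "ai_operator X \<epsilon> E T \<longleftrightarrow>
     linear_map_on E X T \<and> (\<forall>e\<in>X \<inter> E. T e = e) \<and>
     (\<forall>e\<in>E. inverse (1 + \<epsilon>) * norm e \<le> norm (T e) \<and> norm (T e) \<le> (1 + \<epsilon>) * norm e)"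

lemma ai_ideal_imp_ai_operator:
  assumes "ai_ideal X" "finite S" "\<epsilon> > 0"
  shows "\<exists>T. ai_operator X \<epsilon> (span S) T"
  using assms unfolding ai_ideal_def ai_operator_def finite_dim_subspace_def by blast

lemma ai_operator_mono:
  assumes T: "ai_operator X \<epsilon> E T" and "E' \<subseteq> E" "0 < \<epsilon>" "\<epsilon> \<le> \<epsilon>'"
  shows "ai_operator X \<epsilon>' E' T"
proof -
  have "inverse (1 + \<epsilon>') * norm e \<le> norm (T e) \<and> norm (T e) \<le> (1 + \<epsilon>') * norm e"
    if "e \<in> E'" for e
  proof -
    have "inverse (1 + \<epsilon>') * norm e \<le> inverse (1 + \<epsilon>) * norm e"
      using assms by (intro mult_right_mono) auto
    moreover have "(1 + \<epsilon>) * norm e \<le> (1 + \<epsilon>') * norm e"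
      using assms by (intro mult_right_mono) auto
    moreover have "inverse (1 + \<epsilon>) * norm e \<le> norm (T e)" "norm (T e) \<le> (1 + \<epsilon>) * norm e"
      using T that \<open>E' \<subseteq> E\<close> by (auto simp: ai_operator_def)
    ultimately show ?thesis by linarith
  qed
  with assms show ?thesis
    unfolding ai_operator_def linear_map_on_def by blast
qed

section \<open>Extending a functional along the almost isometries\<close>

text \<open>
  Each property of the limit functional \<open>F\<close> is the membership of \<open>F\<close> in a closed set that
  contains all \<open>f \<circ> T\<close> with \<open>T\<close> defined on a large enough subspace. The bound on \<open>F y\<close> is as
  good as that on \<open>f\<close> because such \<open>T\<close> can be taken with constant \<open>1 + \<epsilon>\<close> for every \<open>\<epsilon> > 0\<close>.
  The last conclusion yields one \<open>T\<close> that controls the norms on all of \<open>span S\<close> and at the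
  same time nearly turns \<open>F\<close> into \<open>f\<close> at \<open>y\<close>; an arbitrary extension need not have it.
\<close>

lemma ai_ideal_extension:
  fixes X :: "'a::real_normed_vector set" and f :: "'a \<Rightarrow> real"
  assumes ai: "ai_ideal X" and lin: "linear_map_on X UNIV f"
    and bound: "\<And>x. x \<in> X \<Longrightarrow> \<bar>f x\<bar> \<le> K * norm x" and "K \<ge> 0"
  obtains F where "linear F" "\<And>x. x \<in> X \<Longrightarrow> F x = f x" "\<And>y. \<bar>F y\<bar> \<le> K * norm y"
    "\<And>S y \<epsilon>. finite S \<Longrightarrow> y \<in> S \<Longrightarrow> \<epsilon> > 0 \<Longrightarrow>
       \<exists>T. ai_operator X \<epsilon> (span S) T \<and> \<bar>f (T y) - F y\<bar> < \<epsilon>"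
proof -
  \<comment> \<open>The sets \<open>A (S, \<epsilon>)\<close> shrink as \<open>S\<close> grows and \<open>\<epsilon>\<close> decreases; a cluster point of the functions
    \<open>f \<circ> T\<close> is a common point of their closures. Values outside \<open>span S\<close> are left free so that
    these sets are nested.\<close>
  define A where "A = (\<lambda>(S, \<epsilon>). {g. \<exists>T. ai_operator X \<epsilon> (span S) T \<and> (\<forall>y\<in>span S. g y = f (T y))})"
  define I where "I = {(S :: 'a set, \<epsilon> :: real). finite S \<and> \<epsilon> > 0}"
  \<comment> \<open>The factor \<open>2\<close> bounds \<open>1 + \<epsilon>\<close> for \<open>\<epsilon> \<le> 1\<close>.\<close>
  define box where "box = (\<Pi>\<^sub>E y\<in>(UNIV :: 'a set). {- (2 * K * norm y) .. 2 * K * norm y})"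
  have "compactin (product_topology (\<lambda>_. euclidean) UNIV) box"
    unfolding box_def by (simp add: compactin_PiE)
  then have compact: "compact box"
    by (simp add: euclidean_product_topology)
  have fip: "box \<inter> (\<Inter>i\<in>J. closure (A i)) \<noteq> {}" if J: "finite J" "J \<subseteq> I" for J
  proof -
    define S where "S = \<Union>(fst ` J)"
    define \<epsilon> where "\<epsilon> = Min (insert 1 (snd ` J))"
    have "finite S" using J by (auto simp: S_def I_def)
    have \<epsilon>: "\<epsilon> > 0" "\<epsilon> \<le> 1" using J by (auto simp: \<epsilon>_def I_def)
    obtain T where T: "ai_operator X \<epsilon> (span S) T"
      using ai_ideal_imp_ai_operator[OF ai \<open>finite S\<close> \<epsilon>(1)] by blast
    define g where "g = (\<lambda>y. if y \<in> span S then f (T y) else 0)"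
    have "\<bar>g y\<bar> \<le> 2 * K * norm y" for y
    proof (cases "y \<in> span S")
      case True
      then have "T y \<in> X" "norm (T y) \<le> (1 + \<epsilon>) * norm y"
        using T by (auto simp: ai_operator_def linear_map_on_def)
      moreover have "(1 + \<epsilon>) * norm y \<le> 2 * norm y"
        using \<epsilon> by (intro mult_right_mono) auto
      ultimately have "\<bar>f (T y)\<bar> \<le> K * (2 * norm y)"
        using bound[of "T y"] mult_left_mono[OF _ \<open>K \<ge> 0\<close>, of "norm (T y)" "2 * norm y"] by linarith
      then show ?thesis using True by (simp add: g_def)
    qed (use \<open>K \<ge> 0\<close> in \<open>simp add: g_def\<close>)
    then have "g \<in> box" by (force simp: box_def abs_le_iff)
    moreover have "g \<in> closure (A i)" if "i \<in> J" for i
    proof -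
      obtain S' \<epsilon>' where i: "i = (S', \<epsilon>')" by fastforce
      have "S' \<subseteq> S" "\<epsilon> \<le> \<epsilon>'"
        using that J(1) by (force simp: i S_def, force simp: i \<epsilon>_def intro!: Min_le)
      then have "span S' \<subseteq> span S" "ai_operator X \<epsilon>' (span S') T"
        using ai_operator_mono[OF T _ \<epsilon>(1)] span_mono by blast+
      then have "g \<in> A i" by (auto simp: A_def i g_def)
      then show ?thesis using closure_subset by blast
    qed
    ultimately show ?thesis by blast
  qed
  have "box \<inter> (\<Inter>i\<in>I. closure (A i)) \<noteq> {}"
    by (rule compact_imp_fip_image[OF compact _ fip]) auto
  then obtain F where F: "F \<in> closure (A (S, \<epsilon>))" if "finite S" "\<epsilon> > 0" for S \<epsilon>
    by (auto simp: I_def)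
  have limit: "F \<in> C" if "closed C" "finite S" "\<epsilon> > 0"
    "\<And>T g. ai_operator X \<epsilon> (span S) T \<Longrightarrow> \<forall>y\<in>span S. g y = f (T y) \<Longrightarrow> g \<in> C" for C S \<epsilon>
  proof -
    have "A (S, \<epsilon>) \<subseteq> C" using that(4) by (auto simp: A_def)
    then show ?thesis using closure_minimal[OF _ \<open>closed C\<close>] F that by blast
  qed
  note cont = continuous_on_product_coordinates
  have "F (x + y) = F x + F y" for x y
  proof -
    have "F \<in> {g. g (x + y) = g x + g y}"
    proof (rule limit[of _ "{x, y}" 1])
      show "closed {g :: 'a \<Rightarrow> real. g (x + y) = g x + g y}"
        by (intro closed_Collect_eq continuous_intros cont)
      fix T g assume T: "ai_operator X 1 (span {x, y}) T" and g: "\<forall>z\<in>span {x, y}. g z = f (T z)"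
      have "x \<in> span {x, y}" "y \<in> span {x, y}" "x + y \<in> span {x, y}"
        by (simp_all add: span_base span_add)
      then show "g \<in> {g. g (x + y) = g x + g y}"
        using T g lin by (auto simp: ai_operator_def linear_map_on_def)
    qed auto
    then show ?thesis by simp
  qed
  moreover have "F (c *\<^sub>R x) = c *\<^sub>R F x" for c x
  proof -
    have "F \<in> {g. g (c *\<^sub>R x) = c *\<^sub>R g x}"
    proof (rule limit[of _ "{x}" 1])
      show "closed {g :: 'a \<Rightarrow> real. g (c *\<^sub>R x) = c *\<^sub>R g x}"
        by (intro closed_Collect_eq continuous_intros cont)
      fix T g assume T: "ai_operator X 1 (span {x}) T" and g: "\<forall>z\<in>span {x}. g z = f (T z)"
      have "x \<in> span {x}" "c *\<^sub>R x \<in> span {x}"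
        by (simp_all add: span_base span_scale)
      then show "g \<in> {g. g (c *\<^sub>R x) = c *\<^sub>R g x}"
        using T g lin by (auto simp: ai_operator_def linear_map_on_def)
    qed auto
    then show ?thesis by simp
  qed
  ultimately have "linear F" by (rule linearI)
  moreover have "F x = f x" if "x \<in> X" for x
  proof -
    have "F \<in> {g. g x = f x}"
    proof (rule limit[of _ "{x}" 1])
      show "closed {g. g x = f x}"
        by (intro closed_Collect_eq continuous_intros cont)
    qed (use that in \<open>auto simp: ai_operator_def span_base\<close>)
    then show ?thesis by simp
  qed
  moreover have "\<bar>F y\<bar> \<le> K * norm y" for y
  proof -
    have bd: "\<bar>F y\<bar> \<le> K * ((1 + \<epsilon>) * norm y)" if "\<epsilon> > 0" for \<epsilon>
    proof -
      have "F \<in> {g. \<bar>g y\<bar> \<le> K * ((1 + \<epsilon>) * norm y)}"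
      proof (rule limit[of _ "{y}" \<epsilon>])
        show "closed {g. \<bar>g y\<bar> \<le> K * ((1 + \<epsilon>) * norm y)}"
          by (intro closed_Collect_le continuous_intros cont)
        fix T g assume T: "ai_operator X \<epsilon> (span {y}) T" and g: "\<forall>z\<in>span {y}. g z = f (T z)"
        have "y \<in> span {y}" by (simp add: span_base)
        with T g have "g y = f (T y)" "T y \<in> X" "norm (T y) \<le> (1 + \<epsilon>) * norm y"
          by (auto simp: ai_operator_def linear_map_on_def)
        then show "g \<in> {g. \<bar>g y\<bar> \<le> K * ((1 + \<epsilon>) * norm y)}"
          using bound[of "T y"] mult_left_mono[OF _ \<open>K \<ge> 0\<close>, of "norm (T y)"] by fastforce
      qed (use that in auto)
      then show ?thesis by simp
    qed
    have "((\<lambda>\<epsilon>. K * ((1 + \<epsilon>) * norm y)) \<longlongrightarrow> K * ((1 + 0) * norm y)) (at_right 0)"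
      by (intro tendsto_intros)
    then have "\<bar>F y\<bar> \<le> K * ((1 + 0) * norm y)"
      by (rule tendsto_lowerbound)
        (auto intro: eventually_at_right_less[THEN eventually_mono] bd)
    then show ?thesis by simp
  qed
  moreover have "\<exists>T. ai_operator X \<epsilon> (span S) T \<and> \<bar>f (T y) - F y\<bar> < \<epsilon>"
    if "finite S" "y \<in> S" "\<epsilon> > 0" for S y \<epsilon>
  proof -
    have "open {g :: 'a \<Rightarrow> real. \<bar>g y - F y\<bar> < \<epsilon>}"
      by (intro open_Collect_less continuous_intros cont)
    moreover have "F \<in> {g. \<bar>g y - F y\<bar> < \<epsilon>}" using that by simp
    ultimately have "A (S, \<epsilon>) \<inter> {g. \<bar>g y - F y\<bar> < \<epsilon>} \<noteq> {}"
      using F that open_Int_closure_eq_empty by blast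
    then show ?thesis using \<open>y \<in> S\<close> by (auto simp: A_def span_base)
  qed
  ultimately show thesis by (rule that)
qed

section \<open>Relative operator norms and rank one operators\<close>

lemma onorm_on_upper:
  assumes "\<And>x. x \<in> E \<Longrightarrow> norm (T x) \<le> norm x * K" "K \<ge> 0" "x \<in> E" "T 0 = 0"
  shows "norm (T x) \<le> onorm_on E T * norm x"
proof (cases "x = 0")
  case False
  have "bdd_above ((\<lambda>x. norm (T x) / norm x) ` E)"
    using assms by (intro bdd_aboveI[of _ K]) (auto simp: divide_le_eq mult.commute)
  then have "norm (T x) / norm x \<le> onorm_on E T"
    unfolding onorm_on_def using \<open>x \<in> E\<close> by (intro cSUP_upper)
  then show ?thesis using False by (simp add: divide_le_eq)
qed (simp add: \<open>T 0 = 0\<close>)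

lemma onorm_on_least:
  assumes "E \<noteq> {}" "K \<ge> 0" "\<And>x. x \<in> E \<Longrightarrow> norm (T x) \<le> K * norm x"
  shows "onorm_on E T \<le> K"
  unfolding onorm_on_def using assms by (intro cSUP_least) (auto simp: divide_le_eq)

lemma onorm_on_nonneg:
  assumes "0 \<in> E" "\<And>x. x \<in> E \<Longrightarrow> norm (T x) \<le> norm x * K" "K \<ge> 0"
  shows "onorm_on E T \<ge> 0"
proof -
  have "bdd_above ((\<lambda>x. norm (T x) / norm x) ` E)"
    using assms by (intro bdd_aboveI[of _ K]) (auto simp: divide_le_eq mult.commute)
  from cSUP_upper[OF \<open>0 \<in> E\<close> this] show ?thesis by (simp add: onorm_on_def)
qed

lemma rank_one_map_on_representation:
  fixes T :: "'a::real_vector \<Rightarrow> 'a"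
  assumes X: "subspace X" and T: "linear_map_on X X T" and dim: "dim (T ` X) = 1"
  obtains f x0 u where "linear_map_on X UNIV f" "x0 \<in> X" "x0 \<noteq> 0" "u \<in> X" "f u = (1::real)"
    "\<And>x. x \<in> X \<Longrightarrow> T x = f x *\<^sub>R x0"
proof -
  obtain B where B: "B \<subseteq> T ` X" "independent B" "T ` X \<subseteq> span B" "card B = dim (T ` X)"
    using basis_exists by blast
  then obtain x0 where x0: "B = {x0}" using dim card_1_singletonE by metis
  have "x0 \<noteq> 0" using B x0 dependent_zero by blast
  obtain u where u: "u \<in> X" "T u = x0" using B x0 by auto
  have "\<forall>x\<in>X. \<exists>c. T x = c *\<^sub>R x0" using B(3) x0 by (auto simp: span_singleton)
  then obtain f where f: "\<And>x. x \<in> X \<Longrightarrow> T x = f x *\<^sub>R x0" by metis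
  have "f (x + y) = f x + f y" if "x \<in> X" "y \<in> X" for x y
  proof -
    have "f (x + y) *\<^sub>R x0 = (f x + f y) *\<^sub>R x0"
      using f[symmetric] that T X by (simp add: subspace_add scaleR_add_left linear_map_on_def)
    then show ?thesis using \<open>x0 \<noteq> 0\<close> by (simp only: scaleR_cancel_right) simp
  qed
  moreover have "f (c *\<^sub>R x) = c *\<^sub>R f x" if "x \<in> X" for c x
  proof -
    have "f (c *\<^sub>R x) *\<^sub>R x0 = c *\<^sub>R (f x *\<^sub>R x0)"
      using f[symmetric] that T X by (simp add: subspace_scale linear_map_on_def)
    then show ?thesis using \<open>x0 \<noteq> 0\<close> by simp
  qed
  ultimately have "linear_map_on X UNIV f" by (simp add: linear_map_on_def)
  moreover have "f u = 1" using f[OF u(1)] u \<open>x0 \<noteq> 0\<close> by (metis scaleR_cancel_right scaleR_one)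
  moreover have "x0 \<in> X" using u T by (auto simp: linear_map_on_def)
  ultimately show thesis using that u \<open>x0 \<noteq> 0\<close> f by blast
qed

section \<open>The Daugavet property of an almost isometric ideal\<close>

theorem proposition3p8:
  fixes X :: "'a::banach set"
  assumes "closed X"
    and "ai_ideal X"
    and "daugavet_property (UNIV :: 'a set)"
  shows "daugavet_property X"
  unfolding daugavet_property_def
proof (intro allI impI)
  fix T assume "bounded_linear_map_on X X T \<and> dim (T ` X) = 1"
  then have T: "linear_map_on X X T" and dim: "dim (T ` X) = 1"
    and "\<exists>K. \<forall>x\<in>X. norm (T x) \<le> norm x * K"
    by (auto simp: bounded_linear_map_on_def)
  then obtain K where "\<forall>x\<in>X. norm (T x) \<le> norm x * K" by blast
  then have K: "norm (T x) \<le> norm x * \<bar>K\<bar>" if "x \<in> X" for x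
    using that mult_left_mono[of K "\<bar>K\<bar>" "norm x"] by fastforce
  have X: "subspace X" using \<open>ai_ideal X\<close> by (simp add: ai_ideal_def)
  then have "0 \<in> X" by (rule subspace_0)
  obtain f x0 u where f: "linear_map_on X UNIV f" and x0: "x0 \<in> X" "x0 \<noteq> 0"
    and u: "u \<in> X" "f u = 1" and Tf: "\<And>x. x \<in> X \<Longrightarrow> T x = f x *\<^sub>R x0"
    using rank_one_map_on_representation[OF X T dim] by metis
  have "T 0 = 0" using T \<open>0 \<in> X\<close> by (metis linear_map_on_def scaleR_zero_left)
  let ?N = "onorm_on X T" and ?M = "onorm_on X (\<lambda>x. x + T x)"
  have N: "norm (T x) \<le> ?N * norm x" if "x \<in> X" for x
    using onorm_on_upper[OF K _ that \<open>T 0 = 0\<close>] by simp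
  have N0: "?N \<ge> 0" using onorm_on_nonneg[OF \<open>0 \<in> X\<close> K] by simp
  have I_T: "norm (x + T x) \<le> (1 + ?N) * norm x" if "x \<in> X" for x
    using norm_triangle_ineq[of x "T x"] N[OF that] by (simp add: algebra_simps)
  then have I_T': "norm (x + T x) \<le> norm x * (1 + ?N)" if "x \<in> X" for x
    using that by (simp add: mult.commute)
  have M: "norm (x + T x) \<le> ?M * norm x" if "x \<in> X" for x
    using onorm_on_upper[OF I_T' _ that] \<open>T 0 = 0\<close> N0 by simp
  have M0: "?M \<ge> 0" using onorm_on_nonneg[OF \<open>0 \<in> X\<close> I_T'] N0 by simp

  have f_bound: "\<bar>f x\<bar> \<le> ?N / norm x0 * norm x" if "x \<in> X" for x
    using N[OF that] x0 by (simp add: Tf[OF that] field_simps)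
  obtain F where F: "linear F" "\<And>x. x \<in> X \<Longrightarrow> F x = f x"
      "\<And>y. \<bar>F y\<bar> \<le> ?N / norm x0 * norm y"
    and approx: "\<And>S y \<epsilon>. finite S \<Longrightarrow> y \<in> S \<Longrightarrow> \<epsilon> > 0 \<Longrightarrow>
       \<exists>P. ai_operator X \<epsilon> (span S) P \<and> \<bar>f (P y) - F y\<bar> < \<epsilon>"
    using ai_ideal_extension[OF \<open>ai_ideal X\<close> f f_bound] N0 by (metis divide_nonneg_nonneg norm_ge_zero)
  define R where "R = (\<lambda>y. F y *\<^sub>R x0)"
  have R: "bounded_linear R"
  proof (rule bounded_linear_intro)
    show "norm (R y) \<le> norm y * ?N" for y
      using F(3)[of y] x0 by (simp add: R_def field_simps)
  qed (simp_all add: R_def linear_add[OF F(1)] linear_scale[OF F(1)] scaleR_add_left)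
  have "range R = span {x0}"
  proof -
    have "R (c *\<^sub>R u) = c *\<^sub>R x0" for c
      using u F(2)[of u] by (simp add: R_def linear_scale[OF F(1)])
    then have "c *\<^sub>R x0 \<in> range R" for c by (metis rangeI)
    then show ?thesis by (auto simp: span_singleton R_def)
  qed
  then have "dim (range R) = 1"
    using x0 by (simp add: dim_eq_card_independent)
  then have Daugavet: "onorm (\<lambda>y. y + R y) = 1 + onorm R"
    using \<open>daugavet_property UNIV\<close> R by (simp add: daugavet_property_UNIV)
  have "?N \<le> onorm R"
  proof (rule onorm_on_least)
    show "norm (T x) \<le> onorm R * norm x" if "x \<in> X" for x
      using onorm[OF R, of x] Tf[OF that] F(2)[OF that] by (simp add: R_def)
  qed (use \<open>0 \<in> X\<close> onorm_pos_le[OF R] in auto)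
  moreover have "onorm (\<lambda>y. y + R y) \<le> ?M"
  proof (rule onorm_bound[OF M0])
    fix y
    have bd: "norm (y + R y) \<le> (1 + \<epsilon>) * (?M * ((1 + \<epsilon>) * norm y) + \<epsilon> * norm x0)" if "\<epsilon> > 0" for \<epsilon>
    proof -
      obtain P where P: "ai_operator X \<epsilon> (span {y, x0}) P" and close: "\<bar>f (P y) - F y\<bar> < \<epsilon>"
        using approx[of "{y, x0}" y \<epsilon>] \<open>\<epsilon> > 0\<close> by auto
      have in_span: "y \<in> span {y, x0}" "x0 \<in> span {y, x0}" "R y \<in> span {y, x0}"
        "y + R y \<in> span {y, x0}"
        by (simp_all add: R_def span_base span_add span_scale)
      then have Py: "P y \<in> X" "norm (P y) \<le> (1 + \<epsilon>) * norm y"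
        and P_sum: "P (y + R y) = P y + F y *\<^sub>R x0"
        and "inverse (1 + \<epsilon>) * norm (y + R y) \<le> norm (P (y + R y))"
        using P x0 by (auto simp: ai_operator_def linear_map_on_def R_def)
      then have "norm (y + R y) \<le> (1 + \<epsilon>) * norm (P y + F y *\<^sub>R x0)"
        using \<open>\<epsilon> > 0\<close> by (simp add: field_simps)
      also have "norm (P y + F y *\<^sub>R x0) \<le> ?M * ((1 + \<epsilon>) * norm y) + \<epsilon> * norm x0"
      proof -
        have "P y + F y *\<^sub>R x0 = (P y + T (P y)) - (f (P y) - F y) *\<^sub>R x0"
          by (simp add: Tf[OF Py(1)] algebra_simps)
        then have "norm (P y + F y *\<^sub>R x0) \<le> norm (P y + T (P y)) + norm ((f (P y) - F y) *\<^sub>R x0)"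
          by (metis norm_triangle_ineq4)
        moreover have "norm ((f (P y) - F y) *\<^sub>R x0) \<le> \<epsilon> * norm x0"
          using close by (simp add: mult_right_mono)
        moreover have "norm (P y + T (P y)) \<le> ?M * ((1 + \<epsilon>) * norm y)"
          using M[OF Py(1)] mult_left_mono[OF Py(2) M0] by linarith
        ultimately show ?thesis by linarith
      qed
      finally show ?thesis using \<open>\<epsilon> > 0\<close> by simp
    qed
    have "((\<lambda>\<epsilon>. (1 + \<epsilon>) * (?M * ((1 + \<epsilon>) * norm y) + \<epsilon> * norm x0)) \<longlongrightarrow>
        (1 + 0) * (?M * ((1 + 0) * norm y) + 0 * norm x0)) (at_right 0)"
      by (intro tendsto_intros)
    then have "norm (y + R y) \<le> (1 + 0) * (?M * ((1 + 0) * norm y) + 0 * norm x0)"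
      by (rule tendsto_lowerbound)
        (auto intro: eventually_at_right_less[THEN eventually_mono] bd)
    then show "norm (y + R y) \<le> ?M * norm y" by simp
  qed
  moreover have "?M \<le> 1 + ?N"
    using \<open>0 \<in> X\<close> N0 I_T by (intro onorm_on_least) auto
  ultimately show "?M = 1 + ?N" using Daugavet by linarith
qed

end
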